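(* Let $\lambda \in \mathbb{Q}\cap(0,1)$ and write $\lambda = \frac{a}{b}$ in reduced form, with $a,b$ positive integers. If $b$ is odd, then any collection of pairwise orthogonal exponential functions in the Hilbert space $L^2(X_\lambda,\nu_\lambda)$ has only finitely many elements. If $b$ is even, then there exists a countably infinite collection of pairwise orthogonal exponential functions in $L^2(X_\lambda,\nu_\lambda)$.
   Context: For $\lambda\in(0,1)$ let $\tau_+(x)=\lambda x+1$ and $\tau_-(x)=\lambda x-1$ on $\mathbb{R}$. The measure $\nu_\lambda$ is the unique Borel probability measure on $\mathbb{R}$ (Bernoulli convolution measure) satisfying $\nu_\lambda=\frac12(\nu_\lambda\circ\tau_+^{-1}+\nu_\lambda\circ\tau_-^{-1})$, and $X_\lambda\subset\mathbb{R}$ is its support, i.e. the attractor (compact invariant set) of the iterated function system $\{\tau_+,\tau_-\}$. An exponential function is a function $e_\ell(x)=e^{2\pi i\ell x}$ with $\ell\in\mathbb{R}$. A collection $\{e_\ell:\ell\in\Lambda\}$ with $\Lambda\subset\mathbb{R}$ is pairwise orthogonal if $\int e_\ell\,\overline{e_{\ell'}}\,d\nu_\lambda=0$ for all distinct $\ell,\ell'\in\Lambda$. *)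

theory Defs
  imports "HOL-Probability.Probability"
begin

definition tau_plus :: "real \<Rightarrow> real \<Rightarrow> real" where
  "tau_plus lam x = lam * x + 1"

definition tau_minus :: "real \<Rightarrow> real \<Rightarrow> real" where
  "tau_minus lam x = lam * x - 1"

definition bernoulli_invariant :: "real \<Rightarrow> real measure \<Rightarrow> bool" where
  "bernoulli_invariant lam M \<longleftrightarrow> prob_space M \<and> sets M = sets borel \<and>
     (\<forall>A\<in>sets borel. measure M A = (measure M (tau_plus lam -` A) + measure M (tau_minus lam -` A)) / 2)"

text \<open>Existence and uniqueness, for \<open>0 < lam < 1\<close>, are proved in \<open>bernoulli_invariant_ex1\<close> below;
  outside this range the value is unspecified.\<close>

definition bernoulli_conv :: "real \<Rightarrow> real measure" where
  "bernoulli_conv lam = (THE M. bernoulli_invariant lam M)"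

definition measure_support :: "real measure \<Rightarrow> real set" where
  "measure_support M = {x. \<forall>U. open U \<longrightarrow> x \<in> U \<longrightarrow> emeasure M U > 0}"

definition bernoulli_supp :: "real \<Rightarrow> real set" where
  "bernoulli_supp lam = measure_support (bernoulli_conv lam)"

definition expo :: "real \<Rightarrow> real \<Rightarrow> complex" where
  "expo l x = exp (2 * of_real pi * \<i> * of_real l * of_real x)"

text \<open>The inner product of \<open>L\<^sup>2(X, \<nu>)\<close>; since \<open>bernoulli_supp lam\<close> has full measure, it is also the integral
  over the whole line (\<open>bernoulli_inner_eq\<close> below).\<close>

definition bernoulli_inner :: "real \<Rightarrow> (real \<Rightarrow> complex) \<Rightarrow> (real \<Rightarrow> complex) \<Rightarrow> complex" where
  "bernoulli_inner lam f g = (LINT x : bernoulli_supp lam | bernoulli_conv lam. f x * cnj (g x))"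

definition orthogonal_exponentials :: "real \<Rightarrow> real set \<Rightarrow> bool" where
  "orthogonal_exponentials lam \<Lambda> \<longleftrightarrow>
     (\<forall>l\<in>\<Lambda>. \<forall>l'\<in>\<Lambda>. l \<noteq> l' \<longrightarrow> bernoulli_inner lam (expo l) (expo l') = 0)"


subsection \<open>Well-definedness\<close>

abbreviation fair_coin :: "bool pmf" where
  "fair_coin \<equiv> bernoulli_pmf (1/2)"

definition coin_sign :: "bool \<Rightarrow> real" where
  "coin_sign b = (if b then 1 else -1)"

lemma abs_coin_sign [simp]: "\<bar>coin_sign b\<bar> = 1"
  by (simp add: coin_sign_def)

lemma bernoulli_invariant_iff_distr:
  "bernoulli_invariant lam M \<longleftrightarrow> prob_space M \<and> sets M = sets borel \<and>
     M = distr (measure_pmf fair_coin \<Otimes>\<^sub>M M) borel (\<lambda>(b, x). lam * x + coin_sign b)"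
proof (cases "prob_space M \<and> sets M = sets borel")
  case False
  then show ?thesis by (auto simp: bernoulli_invariant_def)
next
  case True
  then interpret prob_space M by simp
  have sM [measurable_cong]: "sets M = sets borel" using True by simp
  then have spM: "space M = UNIV" using sets_eq_imp_space_eq by fastforce
  let ?C = "measure_pmf fair_coin"
  let ?f = "\<lambda>(b, x). lam * x + coin_sign b"
  have f [measurable]: "?f \<in> borel_measurable (?C \<Otimes>\<^sub>M M)"
  proof -
    have [measurable]: "coin_sign \<in> borel_measurable ?C" by simp
    show ?thesis by measurable
  qed
  have eq: "emeasure (distr (?C \<Otimes>\<^sub>M M) borel ?f) A
      = ennreal ((measure M (tau_plus lam -` A) + measure M (tau_minus lam -` A)) / 2)"
    if A [measurable]: "A \<in> sets borel" for A
  proof -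
    have "emeasure (distr (?C \<Otimes>\<^sub>M M) borel ?f) A = emeasure (?C \<Otimes>\<^sub>M M) (?f -` A \<inter> space (?C \<Otimes>\<^sub>M M))"
      by (rule emeasure_distr) (use f A in auto)
    also have "\<dots> = (\<integral>\<^sup>+b. emeasure M (Pair b -` (?f -` A \<inter> space (?C \<Otimes>\<^sub>M M))) \<partial>?C)"
      by (rule emeasure_pair_measure_alt) (use measurable_sets[OF f A] in auto)
    also have "\<dots> = (\<integral>\<^sup>+b. emeasure M ((\<lambda>x. lam * x + coin_sign b) -` A) \<partial>?C)"
      by (intro nn_integral_cong arg_cong2[where f=emeasure]) (auto simp: space_pair_measure spM)
    also have "\<dots> = ennreal (1/2) * emeasure M (tau_plus lam -` A) + ennreal (1/2) * emeasure M (tau_minus lam -` A)"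
      by (simp add: coin_sign_def tau_plus_def [abs_def] tau_minus_def [abs_def] mult.commute)
    also have "\<dots> = ennreal ((measure M (tau_plus lam -` A) + measure M (tau_minus lam -` A)) / 2)"
      by (simp add: emeasure_eq_measure add_divide_distrib ennreal_plus ennreal_divide_numeral[symmetric]
               divide_ennreal_def mult.commute)
    finally show ?thesis .
  qed
  have "M = distr (?C \<Otimes>\<^sub>M M) borel ?f \<longleftrightarrow>
      (\<forall>A\<in>sets borel. emeasure M A = emeasure (distr (?C \<Otimes>\<^sub>M M) borel ?f) A)"
    using sM by (auto intro!: measure_eqI)
  also have "\<dots> \<longleftrightarrow> (\<forall>A\<in>sets borel. measure M A = (measure M (tau_plus lam -` A) + measure M (tau_minus lam -` A)) / 2)"
    by (intro ball_cong) (simp_all add: eq emeasure_eq_measure)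
  finally show ?thesis
    using True by (simp add: bernoulli_invariant_def)
qed

lemma bernoulli_invariant_char:
  assumes "bernoulli_invariant lam M"
  shows "char M t = (\<integral>b. iexp (t * coin_sign b) \<partial>fair_coin) * char M (lam * t)"
proof -
  have M: "prob_space M" "sets M = sets borel"
    and D: "M = distr (measure_pmf fair_coin \<Otimes>\<^sub>M M) borel (\<lambda>(b, x). lam * x + coin_sign b)"
    using assms unfolding bernoulli_invariant_iff_distr by auto
  note [measurable_cong] = M(2)
  interpret M: prob_space M by fact
  let ?C = "measure_pmf fair_coin"
  interpret P: pair_prob_space ?C M by unfold_locales
  have [measurable]: "coin_sign \<in> borel_measurable ?C" by simp
  have "char M t = (\<integral>x. iexp (t * x) \<partial>distr (?C \<Otimes>\<^sub>M M) borel (\<lambda>(b, x). lam * x + coin_sign b))"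
    unfolding char_def by (subst (1) D) simp
  also have "\<dots> = (\<integral>(b, x). iexp (t * (lam * x + coin_sign b)) \<partial>(?C \<Otimes>\<^sub>M M))"
    by (subst integral_distr) (auto simp: split_beta')
  also have "\<dots> = (\<integral>b. (\<integral>x. iexp (t * (lam * x + coin_sign b)) \<partial>M) \<partial>?C)"
    by (subst P.integral_fst'[symmetric])
       (auto simp: split_beta' intro!: P.integrable_const_bound[where B=1])
  also have "\<dots> = (\<integral>b. iexp (t * coin_sign b) * char M (lam * t) \<partial>?C)"
    unfolding char_def
    by (subst integral_mult_right_zero[symmetric])
       (auto intro!: Bochner_Integration.integral_cong simp: exp_add[symmetric] algebra_simps)
  finally show ?thesis by simp
qed

lemma bernoulli_invariant_unique:
  assumes lam: "0 < lam" "lam < 1" and MN: "bernoulli_invariant lam M" "bernoulli_invariant lam N"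
  shows "M = N"
proof -
  have "real_distribution K" if "bernoulli_invariant lam K" for K
    using that sets_eq_imp_space_eq[of K borel]
    by (auto simp: bernoulli_invariant_def real_distribution_def real_distribution_axioms_def)
  then interpret M: real_distribution M + N: real_distribution N using MN by auto
  define d where "d t = norm (char M t - char N t)" for t
  have step: "d t \<le> d (lam * t)" for t
  proof -
    have "norm (\<integral>b. iexp (t * coin_sign b) \<partial>fair_coin) \<le> (\<integral>b. norm (iexp (t * coin_sign b)) \<partial>fair_coin)"
      by (rule integral_norm_bound)
    also have "\<dots> = 1" by simp
    finally have 1: "norm (\<integral>b. iexp (t * coin_sign b) \<partial>fair_coin) \<le> 1" .
    have "d t = norm (\<integral>b. iexp (t * coin_sign b) \<partial>fair_coin) * d (lam * t)"
      unfolding d_def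
      by (simp only: bernoulli_invariant_char[OF MN(1), of t] bernoulli_invariant_char[OF MN(2), of t]
            norm_mult[symmetric] right_diff_distrib)
    then show ?thesis using 1 by (simp add: d_def mult_left_le_one_le)
  qed
  have "d t \<le> d (lam ^ n * t)" for t n
    by (induction n) (auto intro: order_trans[OF _ step] simp: mult.assoc)
  moreover have "(\<lambda>n. d (lam ^ n * t)) \<longlonglongrightarrow> 0" for t
  proof -
    have "isCont d 0" unfolding d_def by (intro continuous_intros M.isCont_char N.isCont_char)
    moreover have "(\<lambda>n. lam ^ n * t) \<longlonglongrightarrow> 0"
      using lam by (auto intro!: tendsto_eq_intros LIMSEQ_power_zero)
    ultimately have "(\<lambda>n. d (lam ^ n * t)) \<longlonglongrightarrow> d 0" by (rule isCont_tendsto_compose)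
    then show ?thesis by (simp add: d_def M.char_zero N.char_zero)
  qed
  ultimately have "d t \<le> 0" for t
    using LIMSEQ_le_const by blast
  then have "char M = char N" by (auto simp: d_def)
  then show ?thesis
    using Levy_uniqueness M.real_distribution_axioms N.real_distribution_axioms by blast
qed

lemma bernoulli_invariant_exists:
  assumes lam: "0 < lam" "lam < 1"
  shows "\<exists>M. bernoulli_invariant lam M"
proof -
  let ?C = "measure_pmf fair_coin"
  interpret sequence_space ?C by unfold_locales
  define F where "F \<omega> = (\<Sum>n. coin_sign (\<omega> n) * lam ^ n)" for \<omega>
  have sm: "summable (\<lambda>n. coin_sign (\<omega> n) * lam ^ n)" for \<omega>
  proof (rule summable_comparison_test')
    show "summable (\<lambda>n. lam ^ n)" using lam by (intro summable_geometric) auto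
    show "norm (coin_sign (\<omega> n) * lam ^ n) \<le> lam ^ n" if "0 \<le> n" for n
      using lam by (simp add: abs_mult)
  qed
  have F_Cons: "F (case_nat b \<omega>) = lam * F \<omega> + coin_sign b" for b \<omega>
    unfolding F_def
    using suminf_split_head[OF sm[of "case_nat b \<omega>"]] suminf_mult[OF sm[of \<omega>], of lam]
    by (simp add: algebra_simps)
  have [measurable]: "coin_sign \<in> borel_measurable ?C" by simp
  have F [measurable]: "F \<in> borel_measurable S"
    unfolding F_def by measurable
  define M where "M = distr S borel F"
  have pM: "prob_space M" unfolding M_def by (intro P.prob_space_distr F)
  interpret M: prob_space M by fact
  have sM [measurable_cong]: "sets M = sets borel" by (simp add: M_def)
  have "M = distr (distr (?C \<Otimes>\<^sub>M S) S (\<lambda>(s, \<omega>). case_nat s \<omega>)) borel F"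
    by (simp only: PiM_iter M_def)
  also have "\<dots> = distr (?C \<Otimes>\<^sub>M S) borel (\<lambda>(s, \<omega>). lam * F \<omega> + coin_sign s)"
    by (subst distr_distr) (auto simp: comp_def split_beta' F_Cons)
  also have "\<dots> = distr (distr (?C \<Otimes>\<^sub>M S) (?C \<Otimes>\<^sub>M borel) (\<lambda>(s, \<omega>). (s, F \<omega>))) borel (\<lambda>(b, x). lam * x + coin_sign b)"
    by (subst distr_distr) (auto simp: comp_def split_beta')
  also have "distr (?C \<Otimes>\<^sub>M S) (?C \<Otimes>\<^sub>M borel) (\<lambda>(s, \<omega>). (s, F \<omega>)) = distr ?C ?C (\<lambda>x. x) \<Otimes>\<^sub>M M"
    unfolding M_def
    by (rule pair_measure_distr[symmetric])
       (auto intro: prob_space_imp_sigma_finite pM[unfolded M_def])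
  finally show ?thesis
    using pM sM by (auto simp: bernoulli_invariant_iff_distr)
qed

lemma bernoulli_invariant_ex1:
  assumes "0 < lam" "lam < 1"
  shows "\<exists>!M. bernoulli_invariant lam M"
  using bernoulli_invariant_exists[OF assms] bernoulli_invariant_unique[OF assms] by blast

lemma bernoulli_invariant_bernoulli_conv:
  assumes "0 < lam" "lam < 1"
  shows "bernoulli_invariant lam (bernoulli_conv lam)"
  unfolding bernoulli_conv_def using theI'[OF bernoulli_invariant_ex1[OF assms]] .

lemma closed_measure_support: "closed (measure_support M)"
proof -
  have "- measure_support M = \<Union>{U. open U \<and> emeasure M U = 0}"
    by (auto simp: measure_support_def zero_less_iff_neq_zero)
  then show ?thesis by (auto simp: closed_def)
qed

lemma AE_measure_support:
  assumes "sets M = sets borel"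
  shows "AE x in M. x \<in> measure_support M"
proof -
  let ?N = "{U. open U \<and> emeasure M U = 0}"
  obtain F where F: "F \<subseteq> ?N" "countable F" "\<Union>F = \<Union>?N"
    using Lindelof[of ?N] by blast
  have "(\<Union>U\<in>F. U) \<in> null_sets M"
    using F(1,2) assms by (intro null_sets_UN') (auto simp: null_sets_def)
  moreover have "- measure_support M = \<Union>?N"
    by (auto simp: measure_support_def zero_less_iff_neq_zero)
  ultimately have "- measure_support M \<in> null_sets M" using F(3) by simp
  then show ?thesis by (rule AE_I') auto
qed

lemma bernoulli_inner_eq:
  assumes "0 < lam" "lam < 1"
    and "f \<in> borel_measurable borel" "g \<in> borel_measurable borel"
  shows "bernoulli_inner lam f g = (\<integral>x. f x * cnj (g x) \<partial>bernoulli_conv lam)"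
proof -
  have s [measurable_cong]: "sets (bernoulli_conv lam) = sets borel"
    using bernoulli_invariant_bernoulli_conv[OF assms(1,2)] by (simp add: bernoulli_invariant_def)
  have [measurable]: "bernoulli_supp lam \<in> sets borel"
    unfolding bernoulli_supp_def by (intro borel_closed closed_measure_support)
  note [measurable] = assms(3,4)
  have [measurable]: "cnj \<in> borel_measurable borel"
    by (intro borel_measurable_continuous_onI continuous_intros)
  show ?thesis
    unfolding bernoulli_inner_def set_lebesgue_integral_def
    by (rule integral_cong_AE)
       (use AE_measure_support[OF s] in \<open>auto simp: bernoulli_supp_def[symmetric] elim!: eventually_mono\<close>)
qed

end

theory Submission
  imports Defs
begin

text \<open>
  The inner product of two exponentials is a value of the characteristic function \<open>\<phi>\<close> of the
  Bernoulli convolution, which satisfies \<open>\<phi> t = cos t * \<phi> (lam * t)\<close>. As \<open>\<phi>\<close> is continuous with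
  \<open>\<phi> 0 = 1\<close>, it vanishes at \<open>t\<close> exactly if some factor \<open>cos (lam ^ k * t)\<close> does. Hence \<open>expo l\<close> and
  \<open>expo l'\<close> are orthogonal iff \<open>4 * (l - l') = (b / a) ^ k * i\<close> for some \<open>k\<close> and some odd integer
  \<open>i\<close> (\<open>inner_expo_eq_0_iff\<close>), and the question becomes one about sets of reals all of whose
  differences have this form.

  If \<open>b\<close> is even, then \<open>a\<close> is odd and the set of all \<open>b ^ n / 4\<close> works, because
  \<open>b ^ n - b ^ m = b ^ m * (b ^ (n - m) - 1)\<close> is \<open>b ^ m\<close> times an odd integer.

  If \<open>a\<close> and \<open>b\<close> are both odd, such differences are 2-adic units; since the difference of two 2-adic
  units is not a unit, the set has at most two elements.

  Let finally \<open>b\<close> be odd and \<open>a\<close> even. The exponent \<open>k\<close> of a difference is determined by its 2-adic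
  valuation, which is \<open>-k\<close> times that of \<open>a\<close>, whereas the numerator is divisible by \<open>b ^ k\<close>. Fix
  points \<open>s\<close> and \<open>s + u\<close> of the set. A third point \<open>s + v\<close> of exponent \<open>k\<close> larger than that of
  \<open>u\<close> makes \<open>v\<close> and \<open>v - u\<close> have the same exponent \<open>k\<close>, so a large power of \<open>b\<close> divides the
  numerator of \<open>u\<close>; this bounds \<open>k\<close> (\<open>odd_quotient_exponent_bound\<close>). With all exponents at most
  \<open>K\<close>, scaling by \<open>a ^ K\<close> gives integers that are distinct modulo \<open>2 * a ^ K\<close>, so there are only
  finitely many.
\<close>

section \<open>Orthogonality of two exponentials\<close>

lemma bernoulli_char:
  assumes "bernoulli_invariant lam M"
  shows "char M t = complex_of_real (cos t) * char M (lam * t)"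
proof -
  have "(\<integral>b. iexp (t * coin_sign b) \<partial>fair_coin) = complex_of_real (cos t)"
    by (subst integral_measure_pmf[where A = UNIV])
       (auto simp: UNIV_bool coin_sign_def exp_Euler scaleR_conv_of_real field_simps
             simp flip: cos_of_real sin_of_real)
  then show ?thesis
    using bernoulli_invariant_char[OF assms, of t] by simp
qed

lemma bernoulli_char_eq_0_iff:
  assumes lam: "0 < lam" "lam < 1" and M: "bernoulli_invariant lam M"
  shows "char M t = 0 \<longleftrightarrow> (\<exists>k. cos (lam ^ k * t) = 0)"
proof -
  interpret real_distribution M
    using M sets_eq_imp_space_eq[of M borel]
    by (auto simp: bernoulli_invariant_def real_distribution_def real_distribution_axioms_def)
  have step: "char M (lam ^ k * t) = complex_of_real (cos (lam ^ k * t)) * char M (lam ^ Suc k * t)" for k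
    using bernoulli_char[OF M, of "lam ^ k * t"] by (simp add: mult.assoc)
  show ?thesis
  proof
    assume "\<exists>k. cos (lam ^ k * t) = 0"
    then obtain k where "cos (lam ^ k * t) = 0" by blast
    then have "char M (lam ^ k * t) = 0" using step[of k] by simp
    then have "char M (lam ^ (k - j) * t) = 0" for j
    proof (induction j)
      case (Suc j)
      show ?case
      proof (cases "j < k")
        case True
        then have "Suc (k - Suc j) = k - j" by simp
        then show ?thesis using step[of "k - Suc j"] Suc by simp
      qed (use Suc in simp)
    qed simp
    from this[of k] show "char M t = 0" by simp
  next
    assume 0: "char M t = 0"
    show "\<exists>k. cos (lam ^ k * t) = 0"
    proof (rule ccontr)
      assume "\<nexists>k. cos (lam ^ k * t) = 0"
      then have ne: "cos (lam ^ k * t) \<noteq> 0" for k by blast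
      have zero: "char M (lam ^ k * t) = 0" for k
      proof (induction k)
        case (Suc k)
        then show ?case using step[of k] ne[of k] by simp
      qed (use 0 in simp)
      have "(\<lambda>k. lam ^ k * t) \<longlonglongrightarrow> 0"
        using lam by (auto intro!: tendsto_eq_intros LIMSEQ_power_zero)
      then have "(\<lambda>k. char M (lam ^ k * t)) \<longlonglongrightarrow> char M 0"
        by (rule isCont_tendsto_compose[OF isCont_char])
      then show False by (simp add: zero char_zero LIMSEQ_const_iff)
    qed
  qed
qed

text \<open>The reals \<open>(b / a) ^ k * i\<close> with \<open>i\<close> an odd integer, written without division.\<close>

definition odd_quotient :: "nat \<Rightarrow> nat \<Rightarrow> real \<Rightarrow> bool" where
  "odd_quotient a b x \<longleftrightarrow> (\<exists>k i. odd i \<and> x * real a ^ k = of_int i * real b ^ k)"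

lemma inner_expo_eq_0_iff:
  fixes a b :: nat
  assumes "0 < lam" "lam < 1" "b > 0" "lam = real a / real b"
  shows "bernoulli_inner lam (expo l) (expo l') = 0 \<longleftrightarrow> odd_quotient a b (4 * l - 4 * l')"
proof -
  let ?M = "bernoulli_conv lam"
  have M: "bernoulli_invariant lam ?M"
    using assms by (intro bernoulli_invariant_bernoulli_conv)
  have [measurable]: "expo r \<in> borel_measurable borel" for r
    unfolding expo_def by (intro borel_measurable_continuous_onI continuous_intros)
  have "bernoulli_inner lam (expo l) (expo l') = (\<integral>x. expo l x * cnj (expo l' x) \<partial>?M)"
    using assms by (intro bernoulli_inner_eq) auto
  also have "\<dots> = char ?M (2 * pi * (l - l'))"
    unfolding char_def
    by (intro Bochner_Integration.integral_cong refl)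
       (simp add: expo_def exp_cnj exp_add[symmetric] algebra_simps)
  finally have "bernoulli_inner lam (expo l) (expo l') = 0 \<longleftrightarrow> (\<exists>k. cos (lam ^ k * (2 * pi * (l - l'))) = 0)"
    using bernoulli_char_eq_0_iff[OF assms(1,2) M] by simp
  also have "\<dots> \<longleftrightarrow> odd_quotient a b (4 * l - 4 * l')"
    unfolding odd_quotient_def
  proof (intro ex_cong1)
    fix k
    have "cos (lam ^ k * (2 * pi * (l - l'))) = 0 \<longleftrightarrow>
        (\<exists>i. odd i \<and> lam ^ k * (2 * pi * (l - l')) = of_int i * (pi / 2))"
      by (rule cos_zero_iff_int)
    also have "\<dots> \<longleftrightarrow> (\<exists>i. odd i \<and> (4 * l - 4 * l') * real a ^ k = of_int i * real b ^ k)"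
    proof (intro ex_cong1 conj_cong refl)
      fix i
      have "lam ^ k * (2 * pi * (l - l')) = of_int i * (pi / 2) \<longleftrightarrow>
          pi * ((4 * l - 4 * l') * real a ^ k) = pi * (of_int i * real b ^ k)"
        using assms(3) by (simp add: assms(4) power_divide field_simps)
      then show "lam ^ k * (2 * pi * (l - l')) = of_int i * (pi / 2) \<longleftrightarrow>
          (4 * l - 4 * l') * real a ^ k = of_int i * real b ^ k"
        by simp
    qed
    finally show "cos (lam ^ k * (2 * pi * (l - l'))) = 0 \<longleftrightarrow>
        (\<exists>i. odd i \<and> (4 * l - 4 * l') * real a ^ k = of_int i * real b ^ k)" .
  qed
  finally show ?thesis .
qed

section \<open>Sets of reals whose differences are odd quotients\<close>

lemma not_odd_quotient_diff:
  assumes "odd a" "odd b" "odd_quotient a b x" "odd_quotient a b y"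
  shows "\<not> odd_quotient a b (x - y)"
proof
  assume "odd_quotient a b (x - y)"
  then obtain i q where q: "odd q" "(x - y) * real a ^ i = of_int q * real b ^ i"
    by (auto simp: odd_quotient_def)
  obtain j m where m: "odd m" "x * real a ^ j = of_int m * real b ^ j"
    using assms by (auto simp: odd_quotient_def)
  obtain k n where n: "odd n" "y * real a ^ k = of_int n * real b ^ k"
    using assms by (auto simp: odd_quotient_def)
  have "(x * real a ^ j) * real a ^ k * real a ^ i - (y * real a ^ k) * real a ^ j * real a ^ i
      = ((x - y) * real a ^ i) * real a ^ j * real a ^ k"
    by (simp add: algebra_simps)
  then have "of_int (m * int b ^ j * int a ^ k * int a ^ i - n * int b ^ k * int a ^ j * int a ^ i)
      = (of_int (q * int b ^ i * int a ^ j * int a ^ k) :: real)"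
    unfolding q m n by simp
  then have "m * int b ^ j * int a ^ k * int a ^ i - n * int b ^ k * int a ^ j * int a ^ i
      = q * int b ^ i * int a ^ j * int a ^ k"
    by (simp only: of_int_eq_iff)
  moreover have "even (m * int b ^ j * int a ^ k * int a ^ i - n * int b ^ k * int a ^ j * int a ^ i)"
    using m n assms by simp
  moreover have "odd (q * int b ^ i * int a ^ j * int a ^ k)"
    using q assms by simp
  ultimately show False by simp
qed

lemma odd_quotient_exponent_bound:
  fixes a b i j k :: nat and m n q :: int and u v :: real
  assumes a: "even a" "a > 0" and b: "odd b" "b > 1" and ab: "coprime a b"
    and u: "odd m" "u * real a ^ j = of_int m * real b ^ j"
    and v: "odd n" "v * real a ^ k = of_int n * real b ^ k"
    and d: "odd q" "(v - u) * real a ^ i = of_int q * real b ^ i"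
  shows "k \<le> j + nat \<bar>m\<bar>"
proof (cases "k \<le> j")
  case False
  define e where "e = k - j"
  have e: "k = j + e" "e > 0" using False by (auto simp: e_def)
  define N where "N = n * int b ^ k - m * int b ^ j * int a ^ e"
  have "odd N" using a b e v by (simp add: N_def)
  have "(v - u) * real a ^ k = v * real a ^ k - (u * real a ^ j) * real a ^ e"
    by (simp add: e power_add algebra_simps)
  then have N: "(v - u) * real a ^ k = of_int N"
    by (simp add: u v N_def)
  have "of_int (N * int a ^ i) = ((v - u) * real a ^ i) * real a ^ k"
    by (simp add: N[symmetric])
  also have "\<dots> = of_int (q * int b ^ i * int a ^ k)"
    by (simp add: d)
  finally have eq: "N * int a ^ i = q * int b ^ i * int a ^ k"
    by (simp only: of_int_eq_iff)
  have "odd (q * int b ^ i)" using d b by simp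
  \<comment> \<open>Comparing powers of 2 on both sides of \<open>eq\<close>.\<close>
  have "i = k"
  proof (rule ccontr)
    assume "i \<noteq> k"
    then consider r where "i = k + r" "r > 0" | r where "k = i + r" "r > 0"
      by (metis less_imp_add_positive linorder_neqE_nat)
    then show False
    proof cases
      case 1
      then have "N * int a ^ r = q * int b ^ i"
        using eq a by (simp add: power_add)
      then show False using \<open>odd (q * int b ^ i)\<close> a 1 by (metis even_mult_iff even_of_nat even_power)
    next
      case 2
      then have "N = q * int b ^ i * int a ^ r"
        using eq a by (simp add: power_add)
      then show False using \<open>odd N\<close> a 2 by simp
    qed
  qed
  then have "N = q * int b ^ k" using eq a by simp
  then have "int b ^ j * (m * int a ^ e) = int b ^ j * ((n - q) * int b ^ e)"
    by (simp add: N_def e power_add algebra_simps)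
  then have "m * int a ^ e = (n - q) * int b ^ e" using b by simp
  then have "int b ^ e dvd m * int a ^ e" by simp
  moreover have "coprime (int b ^ e) (int a ^ e)"
    using ab by (simp add: coprime_commute)
  ultimately have "int b ^ e dvd m"
    using coprime_dvd_mult_left_iff by blast
  moreover have "m \<noteq> 0" using u by auto
  ultimately have "int b ^ e \<le> \<bar>m\<bar>"
    using dvd_imp_le_int[of m "int b ^ e"] by simp
  moreover have "e < b ^ e" using power_gt_expt[of b e] b(2) by simp
  then have "int e < int b ^ e" by (metis of_nat_less_iff of_nat_power)
  ultimately have "int e \<le> \<bar>m\<bar>" by linarith
  then show ?thesis using e(1) by linarith
qed simp

text \<open>If \<open>a\<close> is odd, there are at most two points. If \<open>a\<close> is even, the map \<open>r\<close> in the proof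
  embeds \<open>S\<close> into the residues modulo \<open>2 * a ^ K\<close>, where \<open>K\<close> bounds the exponents.\<close>

lemma finite_of_odd_quotient_diffs:
  fixes a b :: nat and S :: "real set"
  assumes b: "odd b" "b > 1" and a: "a > 0" and ab: "coprime a b"
    and S: "\<And>x y. x \<in> S \<Longrightarrow> y \<in> S \<Longrightarrow> x \<noteq> y \<Longrightarrow> odd_quotient a b (x - y)"
  shows "finite S"
proof (cases "\<exists>s t. s \<in> S \<and> t \<in> S \<and> s \<noteq> t")
  case False
  then have "S \<subseteq> {SOME s. s \<in> S}" by (metis singleton_iff someI subsetI)
  then show ?thesis using finite_subset by blast
next
  case True
  then obtain s t where st: "s \<in> S" "t \<in> S" "s \<noteq> t" by blast
  show ?thesis
  proof (cases "even a")
    case False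
    have "S \<subseteq> {s, t}"
    proof
      fix x assume "x \<in> S"
      show "x \<in> {s, t}"
      proof (rule ccontr)
        assume "x \<notin> {s, t}"
        then have "odd_quotient a b (x - t)" "odd_quotient a b (s - t)" "odd_quotient a b (x - s)"
          using S st \<open>x \<in> S\<close> by auto
        then show False
          using not_odd_quotient_diff[OF False b(1), of "x - t" "s - t"] by simp
      qed
    qed
    then show ?thesis using finite_subset by blast
  next
    case True
    obtain j m where u: "odd m" "(t - s) * real a ^ j = of_int m * real b ^ j"
      using S[of t s] st by (auto simp: odd_quotient_def)
    define K where "K = j + nat \<bar>m\<bar>"
    have int: "\<exists>z. (x - s) * real a ^ K = of_int z" if x: "x \<in> S" for x
    proof -
      obtain k n where kn: "k \<le> K" "(x - s) * real a ^ k = of_int n * real b ^ k"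
      proof (cases "x = s \<or> x = t")
        case True
        then show ?thesis
        proof
          assume "x = s"
          then show ?thesis using that[of 0 0] by simp
        next
          assume "x = t"
          then show ?thesis using that[of j m] u by (simp add: K_def)
        qed
      next
        case False
        then obtain k n where v: "odd n" "(x - s) * real a ^ k = of_int n * real b ^ k"
          using S[of x s] st x by (auto simp: odd_quotient_def)
        obtain i q where "odd q" "((x - s) - (t - s)) * real a ^ i = of_int q * real b ^ i"
          using S[of x t] False st x by (auto simp: odd_quotient_def)
        then have "k \<le> K"
          unfolding K_def using odd_quotient_exponent_bound[OF True a b ab u v] by blast
        then show ?thesis using that v by blast
      qed
      have "(x - s) * real a ^ K = ((x - s) * real a ^ k) * real a ^ (K - k)"
        using kn(1) by (simp add: mult.assoc flip: power_add)
      also have "\<dots> = of_int (n * int b ^ k * int a ^ (K - k))" by (simp add: kn)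
      finally show ?thesis by blast
    qed
    then obtain z where z: "\<And>x. x \<in> S \<Longrightarrow> (x - s) * real a ^ K = of_int (z x)"
      by metis
    define r where "r x = z x mod (2 * int a ^ K)" for x
    have "inj_on r S"
    proof (rule inj_onI, rule ccontr)
      fix x y assume xy: "x \<in> S" "y \<in> S" "r x = r y" "x \<noteq> y"
      then have "2 * int a ^ K dvd z x - z y"
        by (simp add: r_def mod_eq_dvd_iff)
      \<comment> \<open>Then \<open>x - y\<close> is an even integer, which an odd quotient cannot be as \<open>b\<close> is odd.\<close>
      then obtain c where c: "z x - z y = 2 * int a ^ K * c" by blast
      obtain i q where q: "odd q" "(x - y) * real a ^ i = of_int q * real b ^ i"
        using S[OF xy(1,2,4)] by (auto simp: odd_quotient_def)
      have "(x - y) * real a ^ K = (x - s) * real a ^ K - (y - s) * real a ^ K"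
        by (simp add: algebra_simps)
      also have "\<dots> = of_int (z x - z y)" by (simp add: z xy)
      also have "\<dots> = (2 * of_int c) * real a ^ K" by (simp add: c)
      finally have "x - y = 2 * of_int c" using a by simp
      then have "of_int (2 * c * int a ^ i) = (of_int (q * int b ^ i) :: real)"
        using q by simp
      then have "2 * c * int a ^ i = q * int b ^ i" by (simp only: of_int_eq_iff)
      moreover have "odd (q * int b ^ i)" using q b by simp
      ultimately show False by (metis dvd_triv_left mult.assoc)
    qed
    moreover have "r ` S \<subseteq> {0..<2 * int a ^ K}"
      using a by (auto simp: r_def)
    then have "finite (r ` S)" using finite_subset by blast
    ultimately show ?thesis by (simp add: finite_image_iff)
  qed
qed

lemma odd_quotient_power_diff:
  assumes "even b" "odd a" "m \<noteq> n"
  shows "odd_quotient a b (real b ^ m - real b ^ n)"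
proof -
  have less: "\<exists>c. odd c \<and> real b ^ n - real b ^ m = of_int c * real b ^ m" if mn: "m < n" for m n
  proof -
    have "odd (int b ^ (n - m) - 1)" using mn assms(1) by simp
    moreover have "real b ^ n = real b ^ (n - m) * real b ^ m"
      using mn power_add[of "real b" "n - m" m] by simp
    then have "real b ^ n - real b ^ m = of_int (int b ^ (n - m) - 1) * real b ^ m"
      by (simp add: left_diff_distrib)
    ultimately show ?thesis by blast
  qed
  have "\<exists>c k. odd c \<and> real b ^ m - real b ^ n = of_int c * real b ^ k"
  proof (cases "n < m")
    case False
    then obtain c where "odd c" "real b ^ n - real b ^ m = of_int c * real b ^ m"
      using less[of m n] assms by auto
    then have "odd (- c)" "real b ^ m - real b ^ n = of_int (- c) * real b ^ m" by auto
    then show ?thesis by blast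
  qed (use less in blast)
  then obtain c k where c: "odd c" "real b ^ m - real b ^ n = of_int c * real b ^ k" by blast
  have "(real b ^ m - real b ^ n) * real a ^ k = of_int (c * int a ^ k) * real b ^ k"
    by (simp add: c)
  moreover have "odd (c * int a ^ k)" using c assms by simp
  ultimately show ?thesis unfolding odd_quotient_def by blast
qed

section \<open>Orthogonal families of exponentials\<close>

theorem theorem4p1:
  fixes lam :: real and a b :: nat
  assumes "lam \<in> \<rat>" and "0 < lam" and "lam < 1"
    and "a > 0" and "b > 0" and "coprime a b" and "lam = real a / real b"
  shows "(odd b \<longrightarrow> (\<forall>\<Lambda>. orthogonal_exponentials lam \<Lambda> \<longrightarrow> finite \<Lambda>)) \<and>
         (even b \<longrightarrow> (\<exists>\<Lambda>. orthogonal_exponentials lam \<Lambda> \<and> countable \<Lambda> \<and> infinite \<Lambda>))"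
proof -
  have "a < b" using assms(3,5,7) by simp
  then have b1: "b > 1" using assms(4) by simp
  have orth: "orthogonal_exponentials lam \<Lambda> \<longleftrightarrow>
      (\<forall>l\<in>\<Lambda>. \<forall>l'\<in>\<Lambda>. l \<noteq> l' \<longrightarrow> odd_quotient a b (4 * l - 4 * l'))" for \<Lambda>
    unfolding orthogonal_exponentials_def inner_expo_eq_0_iff[OF assms(2,3,5,7)] ..
  show ?thesis
  proof (intro conjI impI allI)
    fix \<Lambda> assume "odd b" "orthogonal_exponentials lam \<Lambda>"
    then have "finite ((*) 4 ` \<Lambda>)"
      using b1 assms(4,6) by (intro finite_of_odd_quotient_diffs[of b a]) (auto simp: orth)
    then show "finite \<Lambda>" by (rule finite_imageD) (simp add: inj_on_def)
  next
    assume "even b"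
    then have "odd a" using assms(6) by (metis coprime_common_divisor odd_one)
    let ?\<Lambda> = "range (\<lambda>n. real b ^ n / 4)"
    have "inj (\<lambda>n. real b ^ n / 4)" using b1 by (auto simp: inj_on_def)
    then have "infinite ?\<Lambda>" by (rule range_inj_infinite)
    moreover have "orthogonal_exponentials lam ?\<Lambda>"
      unfolding orth
    proof (intro ballI impI)
      fix l l' assume "l \<in> ?\<Lambda>" "l' \<in> ?\<Lambda>" "l \<noteq> l'"
      then obtain m n where "l = real b ^ m / 4" "l' = real b ^ n / 4" "m \<noteq> n" by blast
      then have "4 * l - 4 * l' = real b ^ m - real b ^ n" "m \<noteq> n" by simp_all
      then show "odd_quotient a b (4 * l - 4 * l')"
        using odd_quotient_power_diff[OF \<open>even b\<close> \<open>odd a\<close>, of m n] by simp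
    qed
    ultimately show "\<exists>\<Lambda>. orthogonal_exponentials lam \<Lambda> \<and> countable \<Lambda> \<and> infinite \<Lambda>"
      by blast
  qed
qed

end
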